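(* Let $S$ be an $AG^{*}$-groupoid. Then $S$ is middle nuclear square, i.e. $(ab^{2})c=a(b^{2}c)$ for all $a,b,c\in S$.
   Context: A groupoid is a set $S$ with a binary operation, written as juxtaposition; no associativity or commutativity is assumed, and $b^{2}$ denotes $bb$. An AG-groupoid is a groupoid $S$ satisfying the left invertive law $(ab)c=(cb)a$ for all $a,b,c\in S$. An $AG^{*}$-groupoid is an AG-groupoid satisfying $(ab)c=b(ac)$ for all $a,b,c\in S$. An AG-groupoid $S$ is middle nuclear square if $(ab^{2})c=a(b^{2}c)$ for all $a,b,c\in S$. *)

theory Defs
  imports Main
begin

locale groupoid =
  fixes S :: "'a set" and mult :: "'a \<Rightarrow> 'a \<Rightarrow> 'a" (infixl "\<cdot>" 70)
  assumes closed: "\<lbrakk> a \<in> S; b \<in> S \<rbrakk> \<Longrightarrow> a \<cdot> b \<in> S"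

locale AG_groupoid = groupoid +
  assumes left_invertive:
    "\<lbrakk> a \<in> S; b \<in> S; c \<in> S \<rbrakk> \<Longrightarrow> (a \<cdot> b) \<cdot> c = (c \<cdot> b) \<cdot> a"

locale AG_star_groupoid = AG_groupoid +
  assumes AG_star:
    "\<lbrakk> a \<in> S; b \<in> S; c \<in> S \<rbrakk> \<Longrightarrow> (a \<cdot> b) \<cdot> c = b \<cdot> (a \<cdot> c)"

locale middle_nuclear_square = AG_groupoid +
  assumes middle_nuclear_square:
    "\<lbrakk> a \<in> S; b \<in> S; c \<in> S \<rbrakk> \<Longrightarrow> (a \<cdot> (b \<cdot> b)) \<cdot> c = a \<cdot> ((b \<cdot> b) \<cdot> c)"

end

theory Submission
  imports Defs
begin

text \<open>The two laws make the right factor of any product commute internally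
  (\<open>swap_right\<close>). Expanding both sides by \<open>AG_star\<close> gives b(b(ac)) and
  b(a(bc)), so the theorem reduces to exchanging a and b beneath the outer b, which
  \<open>swap_right\<close> allows.\<close>

context AG_star_groupoid
begin

text \<open>By \<open>AG_star\<close> the two sides are (ba)c and (ca)b, which the left invertive
  law identifies.\<close>

lemma swap_right:
  assumes "a \<in> S" "b \<in> S" "c \<in> S"
  shows "a \<cdot> (b \<cdot> c) = a \<cdot> (c \<cdot> b)"
  using assms by (metis AG_star left_invertive)

lemma square_middle:
  assumes [simp]: "a \<in> S" "b \<in> S" "c \<in> S"
  shows "(a \<cdot> (b \<cdot> b)) \<cdot> c = a \<cdot> ((b \<cdot> b) \<cdot> c)"
proof -
  note [simp] = closed
  have "(a \<cdot> (b \<cdot> b)) \<cdot> c = (b \<cdot> b) \<cdot> (a \<cdot> c)"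
    by (rule AG_star) simp_all
  also have "\<dots> = b \<cdot> (b \<cdot> (a \<cdot> c))"
    by (rule AG_star) simp_all
  also have "\<dots> = b \<cdot> ((a \<cdot> b) \<cdot> c)"
    by (simp add: AG_star [of a b c])
  \<comment> \<open>Only right factors may be swapped: ab moves to the right of c, becomes ba there,
    and moves back.\<close>
  also have "\<dots> = b \<cdot> (c \<cdot> (a \<cdot> b))"
    by (rule swap_right) simp_all
  also have "\<dots> = b \<cdot> (c \<cdot> (b \<cdot> a))"
    by (simp add: swap_right [of c a b])
  also have "\<dots> = b \<cdot> ((b \<cdot> a) \<cdot> c)"
    by (rule swap_right) simp_all
  also have "\<dots> = b \<cdot> (a \<cdot> (b \<cdot> c))"
    by (simp add: AG_star [of b a c])
  \<comment> \<open>\<open>AG_star\<close> read backwards frees c on the right, leaving b(ab) to be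
    regrouped as (bb)a.\<close>
  also have "\<dots> = (a \<cdot> b) \<cdot> (b \<cdot> c)"
    by (rule AG_star [symmetric]) simp_all
  also have "\<dots> = (b \<cdot> (a \<cdot> b)) \<cdot> c"
    by (rule AG_star [symmetric]) simp_all
  also have "\<dots> = (b \<cdot> (b \<cdot> a)) \<cdot> c"
    by (simp add: swap_right [of b a b])
  also have "\<dots> = ((b \<cdot> b) \<cdot> a) \<cdot> c"
    by (simp add: AG_star [of b b a])
  also have "\<dots> = a \<cdot> ((b \<cdot> b) \<cdot> c)"
    by (rule AG_star) simp_all
  finally show ?thesis .
qed

end

theorem lemma12:
  fixes S :: "'a set" and mult :: "'a \<Rightarrow> 'a \<Rightarrow> 'a"
  assumes "AG_star_groupoid S mult"
  shows "middle_nuclear_square S mult"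
proof -
  interpret AG_star_groupoid S mult by fact
  show ?thesis by unfold_locales (rule square_middle)
qed

end
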